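(* For all integers $n\ge 1$, $$\overline{\sigma_o\mathrm{mex}}(n)\equiv 0\pmod 2.$$
   Context: An overpartition of a nonnegative integer $n$ is a non-increasing sequence of positive integers summing to $n$ in which the first occurrence of each distinct integer may (or may not) be overlined; $\overline{\mathcal P}(n)$ denotes the set of all overpartitions of $n$. For an overpartition $\lambda$, $\mathrm{mex}(\lambda)$ is the least positive integer that does not occur as a part of $\lambda$, where a value counts as occurring whether it appears overlined or non-overlined. Put $\mathrm{mex}_o(\lambda)=\mathrm{mex}(\lambda)$ if $\mathrm{mex}(\lambda)$ is odd and $\mathrm{mex}_o(\lambda)=0$ otherwise. Define $\overline{\sigma_o\mathrm{mex}}(n)=\sum_{\lambda\in\overline{\mathcal P}(n)}\mathrm{mex}_o(\lambda)$ for $n\ge 0$. *)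

theory Defs
  imports "HOL-Number_Theory.Cong"
begin

text \<open>
  A part is a pair of its value and a flag telling whether it is overlined. An overpartition is
  a list of parts whose values are positive and non-increasing, where only the first occurrence
  of each value may carry the flag.
\<close>

definition overpartition :: "(nat \<times> bool) list \<Rightarrow> bool" where
  "overpartition xs \<longleftrightarrow>
     sorted_wrt (\<ge>) (map fst xs) \<and>
     (\<forall>p \<in> set xs. fst p > 0) \<and>
     (\<forall>i < length xs. snd (xs ! i) \<longrightarrow> (\<forall>j < i. fst (xs ! j) \<noteq> fst (xs ! i)))"

definition overpartitions :: "nat \<Rightarrow> (nat \<times> bool) list set" where
  "overpartitions n = {xs. overpartition xs \<and> sum_list (map fst xs) = n}"

definition mex :: "(nat \<times> bool) list \<Rightarrow> nat" where
  "mex xs = (LEAST m. m > 0 \<and> m \<notin> fst ` set xs)"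

definition mex_o :: "(nat \<times> bool) list \<Rightarrow> nat" where
  "mex_o xs = (if odd (mex xs) then mex xs else 0)"

definition sigma_o_mex :: "nat \<Rightarrow> nat" where
  "sigma_o_mex n = (\<Sum>xs \<in> overpartitions n. mex_o xs)"

text \<open>The sum above ranges over a finite set, so it is not the default value 0.\<close>

lemma finite_overpartitions: "finite (overpartitions n)"
proof (rule finite_subset)
  let ?A = "{..n} \<times> (UNIV :: bool set)"
  show "finite {xs. set xs \<subseteq> ?A \<and> length xs \<le> n}"
    by (rule finite_lists_length_le) simp
  show "overpartitions n \<subseteq> {xs. set xs \<subseteq> ?A \<and> length xs \<le> n}"
  proof
    fix xs assume "xs \<in> overpartitions n"
    then have pos: "\<forall>p \<in> set xs. fst p > 0" and s: "sum_list (map fst xs) = n"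
      by (auto simp: overpartitions_def overpartition_def)
    have "\<forall>p \<in> set xs. fst p > 0 \<Longrightarrow> length xs \<le> sum_list (map fst xs)"
      by (induction xs) auto
    moreover have "fst p \<le> n" if "p \<in> set xs" for p
      using that s member_le_sum_list[of "fst p" "map fst xs"] by auto
    ultimately show "xs \<in> {xs. set xs \<subseteq> ?A \<and> length xs \<le> n}"
      using pos s by auto
  qed
qed

end

theory Submission
  imports Defs
begin

text \<open>
  The head of a nonempty overpartition is always the first occurrence of its value, so its
  overline can be added or removed freely. Toggling it is a fixed-point-free involution on the
  overpartitions of a positive integer, and it keeps the underlying partition, hence the mex.
  The overpartitions thus fall into pairs with equal \<open>mex_o\<close>, and each pair contributes an even
  number to the sum.
\<close>

fun toggle_head :: "(nat \<times> bool) list \<Rightarrow> (nat \<times> bool) list" where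
  "toggle_head [] = []"
| "toggle_head ((v, b) # ps) = (v, \<not> b) # ps"

lemma toggle_head_involution: "toggle_head (toggle_head xs) = xs"
  by (cases xs rule: toggle_head.cases) auto

lemma map_fst_toggle_head: "map fst (toggle_head xs) = map fst xs"
  by (cases xs rule: toggle_head.cases) auto

lemma overlined_hd_toggle_head:
  "xs \<noteq> [] \<Longrightarrow> snd (hd (toggle_head xs)) \<longleftrightarrow> \<not> snd (hd xs)"
  by (cases xs rule: toggle_head.cases) auto

lemma mex_o_toggle_head: "mex_o (toggle_head xs) = mex_o xs"
proof -
  have "fst ` set (toggle_head xs) = fst ` set xs"
    by (metis map_fst_toggle_head list.set_map)
  then show ?thesis
    by (simp add: mex_o_def mex_def)
qed

text \<open>
  The overlining condition at index 0 is vacuous, and at a later index it involves the flag of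
  that index and the values before it, none of which is the flag of the head.
\<close>

lemma overpartition_Cons_flag:
  "overpartition ((v, b) # ps) \<longleftrightarrow> overpartition ((v, c) # ps)"
  by (simp add: overpartition_def All_less_Suc2)

lemma toggle_head_overpartitions:
  assumes "xs \<in> overpartitions n"
  shows "toggle_head xs \<in> overpartitions n"
proof -
  have "overpartition (toggle_head xs)"
    using assms overpartition_Cons_flag
    by (cases xs rule: toggle_head.cases) (auto simp: overpartitions_def)
  then show ?thesis
    using assms by (simp add: overpartitions_def map_fst_toggle_head)
qed

lemma overpartitions_nonempty_list:
  "n \<ge> 1 \<Longrightarrow> xs \<in> overpartitions n \<Longrightarrow> xs \<noteq> []"
  by (auto simp: overpartitions_def)

theorem corollary1p3:
  fixes n :: nat
  assumes "n \<ge> 1"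
  shows "[sigma_o_mex n = 0] (mod 2)"
proof -
  let ?A = "{xs \<in> overpartitions n. snd (hd xs)}"
  let ?B = "{xs \<in> overpartitions n. \<not> snd (hd xs)}"
  have "(\<Sum>xs \<in> ?A. mex_o xs) = (\<Sum>xs \<in> ?B. mex_o xs)"
    by (rule sum.reindex_bij_witness[of _ toggle_head toggle_head])
      (use assms in \<open>auto simp: toggle_head_involution toggle_head_overpartitions
         mex_o_toggle_head overlined_hd_toggle_head overpartitions_nonempty_list\<close>)
  moreover have "sigma_o_mex n = (\<Sum>xs \<in> ?A. mex_o xs) + (\<Sum>xs \<in> ?B. mex_o xs)"
    unfolding sigma_o_mex_def
    by (subst sum.union_disjoint[symmetric])
      (auto simp: finite_overpartitions intro!: sum.cong)
  ultimately have "sigma_o_mex n = 2 * (\<Sum>xs \<in> ?B. mex_o xs)"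
    by simp
  then show ?thesis
    by (simp add: cong_def)
qed

end
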